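(* Let $(\mathbf{X}',\mathbf{y}')$ be an optimal solution of Problem (P1$'$) (defined in the context) with $\sum_{k\in\mathcal{K}}x'_{k,n}=y'_n$ for all $n\in\mathcal{N}$ (so that $\sum_{n\in\mathcal{N}}y'_n=K$). Let $s=K-\sum_{n\in\mathcal{N}}\lfloor y'_n\rfloor$ and define $\hat{\mathbf{y}}=\{\hat y_n\}_{n\in\mathcal{N}}$ by $$\hat y_n=\begin{cases}\lceil y'_n\rceil, & \text{if } y'_n-\lfloor y'_n\rfloor \text{ is one of the } s \text{ largest among the values } \{y'_m-\lfloor y'_m\rfloor\}_{m\in\mathcal{N}},\\ \lfloor y'_n\rfloor, & \text{otherwise},\end{cases}$$ where exactly $s$ indices are selected for the first case (ties broken arbitrarily). Then: a) $\hat{\mathbf{y}}\in\mathcal{Y}$, i.e., $\hat{\mathbf{y}}$ is an integer vector with $\sum_{n\in\mathcal{N}}\hat y_n=K$ and $0\le \hat y_n\le M_n$ for all $n\in\mathcal{N}$; b) $\hat{\mathbf{y}}\in\arg\min_{\mathbf{y}\in\mathcal{Y}}\|\mathbf{y}-\mathbf{y}'\|_q$ for every $q\ge 1$, i.e., $\hat{\mathbf{y}}$ is one of the closest integer vectors in $\mathcal{Y}$ to $\mathbf{y}'$ for any $\ell_q$ norm with $q\ge 1$.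
   Context: Let $\mathcal{N}=\{1,\dots,N\}$ and $\mathcal{K}=\{1,\dots,K\}$. Given are real numbers $r_{k,n}>0$, $f_{k,n}>0$, $d_n>0$, $\omega_k\ge 0$, $z_{k,n}\ge 0$ for $k\in\mathcal{K},n\in\mathcal{N}$, and positive integers $M_n$ with $\sum_{n\in\mathcal{N}}M_n\ge K$. Problem (P1$'$) is $$\max_{\mathbf{X},\mathbf{y}}\ \sum_{k\in\mathcal{K}}\sum_{n\in\mathcal{N}}\frac{x_{k,n}\omega_k}{\frac{1}{r_{k,n}}+\frac{(1+d_n)^{y_n-1}}{f_{k,n}}}+\sum_{k\in\mathcal{K}}\sum_{n\in\mathcal{N}}x_{k,n}z_{k,n}$$ over $\mathbf{X}=\{x_{k,n}\}\in\mathbb{R}^{K\times N}$ and $\mathbf{y}=\{y_n\}\in\mathbb{R}^N$ subject to $\sum_{n\in\mathcal{N}}x_{k,n}=1$ for all $k$; $\sum_{k\in\mathcal{K}}x_{k,n}\le y_n$ for all $n$; $0\le x_{k,n}\le 1$ for all $k,n$; $0\le y_n\le M_n$ for all $n$. The set of feasible integer load vectors is $\mathcal{Y}=\{\mathbf{y}\in\mathbb{Z}^N : \sum_{n\in\mathcal{N}}y_n=K,\ 0\le y_n\le M_n\ \forall n\in\mathcal{N}\}$. Here $\|\cdot\|_q$ is the usual $\ell_q$ norm on $\mathbb{R}^N$, and $\lfloor\cdot\rfloor$, $\lceil\cdot\rceil$ are floor and ceiling. *)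

theory Defs
  imports "HOL-Analysis.Analysis"
begin

text \<open>
  The index sets of sizes \<open>K\<close> and \<open>N\<close> are the finite types \<open>'k\<close> and \<open>'n\<close>, so
  \<open>K = CARD('k)\<close> and \<open>N = CARD('n)\<close>. The variable \<open>x\<^sub>k\<^sub>,\<^sub>n\<close> is \<open>X $ k $ n\<close>.
\<close>

definition P1_objective ::
  "('k::finite \<Rightarrow> 'n::finite \<Rightarrow> real) \<Rightarrow> ('k \<Rightarrow> 'n \<Rightarrow> real) \<Rightarrow> ('n \<Rightarrow> real) \<Rightarrow> ('k \<Rightarrow> real) \<Rightarrow>
   ('k \<Rightarrow> 'n \<Rightarrow> real) \<Rightarrow> real^'n^'k \<Rightarrow> real^'n \<Rightarrow> real" where
  "P1_objective r f d \<omega> z X y =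
     (\<Sum>k\<in>UNIV. \<Sum>n\<in>UNIV.
        X $ k $ n * \<omega> k / (1 / r k n + (1 + d n) powr (y $ n - 1) / f k n))
     + (\<Sum>k\<in>UNIV. \<Sum>n\<in>UNIV. X $ k $ n * z k n)"

definition P1_feasible ::
  "('n::finite \<Rightarrow> nat) \<Rightarrow> real^'n^'k::finite \<Rightarrow> real^'n \<Rightarrow> bool" where
  "P1_feasible M X y \<longleftrightarrow>
     (\<forall>k. (\<Sum>n\<in>UNIV. X $ k $ n) = 1) \<and>
     (\<forall>n. (\<Sum>k\<in>UNIV. X $ k $ n) \<le> y $ n) \<and>
     (\<forall>k n. 0 \<le> X $ k $ n \<and> X $ k $ n \<le> 1) \<and>
     (\<forall>n. 0 \<le> y $ n \<and> y $ n \<le> real (M n))"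

definition P1_optimal ::
  "('k::finite \<Rightarrow> 'n::finite \<Rightarrow> real) \<Rightarrow> ('k \<Rightarrow> 'n \<Rightarrow> real) \<Rightarrow> ('n \<Rightarrow> real) \<Rightarrow> ('k \<Rightarrow> real) \<Rightarrow>
   ('k \<Rightarrow> 'n \<Rightarrow> real) \<Rightarrow> ('n \<Rightarrow> nat) \<Rightarrow> real^'n^'k \<Rightarrow> real^'n \<Rightarrow> bool" where
  "P1_optimal r f d \<omega> z M X y \<longleftrightarrow>
     is_arg_max (\<lambda>(X, y). P1_objective r f d \<omega> z X y) (\<lambda>(X, y). P1_feasible M X y) (X, y)"

definition load_vectors :: "nat \<Rightarrow> ('n::finite \<Rightarrow> nat) \<Rightarrow> (real^'n) set" where
  "load_vectors K M =
     {y. (\<forall>n. y $ n \<in> \<int>) \<and> (\<Sum>n\<in>UNIV. y $ n) = real K \<and>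
         (\<forall>n. 0 \<le> y $ n \<and> y $ n \<le> real (M n))}"

definition lq_norm :: "real \<Rightarrow> real^'n::finite \<Rightarrow> real" where
  "lq_norm q v = (\<Sum>n\<in>UNIV. \<bar>v $ n\<bar> powr q) powr (1 / q)"

text \<open>
  \<open>largest_selection s v S\<close>: the set \<open>S\<close> is a choice of exactly \<open>s\<close> indices carrying the \<open>s\<close>
  largest values of \<open>v\<close>. If there are ties, several sets \<open>S\<close> qualify.
\<close>

definition largest_selection :: "int \<Rightarrow> ('n::finite \<Rightarrow> real) \<Rightarrow> 'n set \<Rightarrow> bool" where
  "largest_selection s v S \<longleftrightarrow> int (card S) = s \<and> (\<forall>n\<in>S. \<forall>m. m \<notin> S \<longrightarrow> v m \<le> v n)"

definition round_up_on :: "'n set \<Rightarrow> real^'n::finite \<Rightarrow> real^'n" where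
  "round_up_on S y = (\<chi> n. if n \<in> S then of_int \<lceil>y $ n\<rceil> else of_int \<lfloor>y $ n\<rfloor>)"

end

theory Submission
  imports Defs
begin

text \<open>
  Write \<open>t n\<close> for the fractional part of \<open>y' n\<close>. The fractional parts sum to \<open>s\<close> and are less
  than \<open>1\<close>, so at least \<open>s\<close> of them are positive, and the \<open>s\<close> largest are.
  Hence rounding up on \<open>S\<close> instead of down adds exactly \<open>s\<close> to the total.
  For optimality, minimise the \<open>q\<close>-th power of the distance, which is a separable convex cost, and
  use a Lagrange multiplier for the constraint on the total load. Rounding up instead of down costs
  \<open>(1 - t n) powr q - t n powr q\<close>, which decreases with \<open>t n\<close> and lies in \<open>[-1, 1]\<close>. So there is
  a multiplier \<open>c \<in> [-1, 1]\<close> between the costs on \<open>S\<close> and those off \<open>S\<close>, and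
  the rounded value minimises \<open>\<bar>j - y' n\<bar> powr q - c * j\<close> over all integers \<open>j\<close>, for each \<open>n\<close>.
\<close>

text \<open>Superadditivity follows by splitting off one factor:
  \<open>a powr q = a * a powr (q - 1)\<close>, and the remaining power is monotone since
  \<open>q - 1\<close> is nonnegative.\<close>

lemma powr_add_ge_add_powr:
  fixes a b q :: real
  assumes "0 \<le> a" "0 \<le> b" "1 \<le> q"
  shows "a powr q + b powr q \<le> (a + b) powr q"
proof -
  have split: "x powr q = x * x powr (q - 1)" if "0 \<le> x" for x :: real
    using that powr_mult_base[of x "q - 1"] by simp
  have "a * a powr (q - 1) \<le> a * (a + b) powr (q - 1)"
    and "b * b powr (q - 1) \<le> b * (a + b) powr (q - 1)"
    using assms by (auto intro!: mult_left_mono powr_mono2)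
  then show ?thesis
    using split[of a] split[of b] split[of "a + b"] assms by (simp add: distrib_right)
qed

text \<open>Integrality enters here: for \<open>q > 1\<close> the bound fails strictly between 0 and
  1.\<close>

lemma of_nat_le_powr:
  fixes q :: real
  assumes "1 \<le> q"
  shows "real i \<le> real i powr q"
proof (cases "i = 0")
  case False
  then show ?thesis
    using powr_mono[of 1 q "real i"] assms by simp
qed simp

text \<open>This says that \<open>c\<close> is a subgradient at \<open>e\<close> of the cost on the
  integers. Moving right from 1 or left from 0, the cost grows by at least 1 per unit, which
  \<open>c\<close> in [-1, 1] cannot outweigh. Only the step between 0 and 1 is left, and
  \<open>e\<close> is its cheaper end once \<open>c\<close> is charged.\<close>

lemma powr_dist_int_ge_tangent:
  fixes t q c :: real and j e :: int
  assumes t: "0 \<le> t" "t \<le> 1" and q: "1 \<le> q" and c: "-1 \<le> c" "c \<le> 1"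
    and e: "e = 0 \<and> c \<le> (1 - t) powr q - t powr q \<or> e = 1 \<and> (1 - t) powr q - t powr q \<le> c"
  shows "\<bar>e - t\<bar> powr q + c * (j - e) \<le> \<bar>j - t\<bar> powr q"
proof (cases "1 \<le> j")
  case True
  define i where "i = nat (j - 1)"
  have j: "real_of_int j = 1 + real i"
    using True by (simp add: i_def)
  have "(1 - t) powr q + real i \<le> (1 - t) powr q + real i powr q"
    using of_nat_le_powr[OF q] by simp
  also have "\<dots> \<le> \<bar>j - t\<bar> powr q"
    using powr_add_ge_add_powr[of "1 - t" "real i" q] t q j by (simp add: algebra_simps)
  finally have *: "(1 - t) powr q + real i \<le> \<bar>j - t\<bar> powr q" .
  have "c * real i \<le> real i"
    using mult_right_mono[OF c(2), of "real i"] by simp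
  \<comment> \<open>The bound is anchored at 1; for \<open>e = 0\<close> the assumption on
    \<open>c\<close> bridges the step from 0 to 1.\<close>
  with * e t j show ?thesis
    by (auto simp: algebra_simps)
next
  case False
  define i where "i = nat (- j)"
  have j: "real_of_int j = - real i"
    using False by (simp add: i_def)
  have dist: "\<bar>j - t\<bar> = t + real i"
    using j t by simp
  have "t powr q + real i \<le> t powr q + real i powr q"
    using of_nat_le_powr[OF q] by simp
  also have "\<dots> \<le> \<bar>j - t\<bar> powr q"
    using powr_add_ge_add_powr[of t "real i" q] t q dist by simp
  finally have *: "t powr q + real i \<le> \<bar>j - t\<bar> powr q" .
  have "- c * real i \<le> real i"
    using mult_right_mono[of "- c" 1 "real i"] c by simp
  with * e t j show ?thesis
    by (auto simp: algebra_simps)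
qed

text \<open>If a selected value were at most 0, so would be every unselected one, and the total
  would stay strictly below \<open>card S\<close>, which is \<open>s\<close>.\<close>

lemma largest_selection_pos:
  fixes t :: "'n::finite \<Rightarrow> real"
  assumes sel: "largest_selection s t S" and sum: "(\<Sum>n\<in>UNIV. t n) = of_int s"
    and lt1: "\<And>n. t n < 1" and n: "n \<in> S"
  shows "0 < t n"
proof (rule ccontr)
  assume neg: "\<not> 0 < t n"
  have "(\<Sum>m\<in>- S. t m) \<le> 0"
    using sel n neg by (intro sum_nonpos) (force simp: largest_selection_def)
  \<comment> \<open>Strictness needs \<open>S\<close> nonempty, which \<open>n\<close>
    witnesses.\<close>
  moreover have "(\<Sum>m\<in>S. t m) < (\<Sum>m\<in>S. 1)"
    using n lt1 by (intro sum_strict_mono) auto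
  moreover have "(\<Sum>m\<in>UNIV. t m) = (\<Sum>m\<in>S. t m) + (\<Sum>m\<in>- S. t m)"
    using sum.subset_diff[of S UNIV t] by (simp add: Compl_eq_Diff_UNIV add.commute)
  moreover have "real (card S) = of_int s"
    using sel by (auto simp: largest_selection_def)
  ultimately show False
    using sum by simp
qed

lemma largest_selection_separator:
  fixes t :: "'n::finite \<Rightarrow> real" and D :: "real \<Rightarrow> real"
  assumes sel: "largest_selection s t S"
    and anti: "\<And>m n. t m \<le> t n \<Longrightarrow> D (t n) \<le> D (t m)"
    and bounds: "\<And>n. a \<le> D (t n)" "\<And>n. D (t n) \<le> b" "a \<le> b"
  obtains c where "a \<le> c" "c \<le> b" "\<And>n. n \<in> S \<Longrightarrow> D (t n) \<le> c" "\<And>n. n \<notin> S \<Longrightarrow> c \<le> D (t n)"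
proof
  \<comment> \<open>The largest value on \<open>S\<close> separates; inserting \<open>a\<close>
    makes the maximum meaningful for empty \<open>S\<close>.\<close>
  let ?c = "Max (insert a ((\<lambda>n. D (t n)) ` S))"
  show "a \<le> ?c" "?c \<le> b" "\<And>n. n \<in> S \<Longrightarrow> D (t n) \<le> ?c"
    using bounds by auto
  show "?c \<le> D (t n)" if "n \<notin> S" for n
    using that sel bounds(1) by (auto simp: largest_selection_def intro: anti)
qed

text \<open>Positivity excludes integer entries, where ceiling and floor coincide and rounding up
  would add nothing.\<close>

lemma round_up_on_eq_floor:
  assumes "\<And>n. n \<in> S \<Longrightarrow> 0 < frac (y $ n)"
  shows "round_up_on S y $ n = of_int (\<lfloor>y $ n\<rfloor> + (if n \<in> S then 1 else 0))"
proof -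
  have "\<lceil>y $ n\<rceil> = \<lfloor>y $ n\<rfloor> + 1" if "n \<in> S"
    using assms[OF that] by (auto simp: ceiling_altdef frac_def)
  then show ?thesis
    by (simp add: round_up_on_def)
qed

lemma round_up_on_in_load_vectors:
  fixes y :: "real^'n::finite"
  assumes y: "(\<Sum>n\<in>UNIV. y $ n) = real K" "\<And>n. 0 \<le> y $ n" "\<And>n. y $ n \<le> real (M n)"
    and s: "s = int K - (\<Sum>n\<in>UNIV. \<lfloor>y $ n\<rfloor>)"
    and sel: "largest_selection s (\<lambda>n. frac (y $ n)) S"
    and pos: "\<And>n. n \<in> S \<Longrightarrow> 0 < frac (y $ n)"
  shows "round_up_on S y \<in> load_vectors K M"
proof -
  have "(\<Sum>n\<in>UNIV. round_up_on S y $ n)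
      = of_int ((\<Sum>n\<in>UNIV. \<lfloor>y $ n\<rfloor>) + (\<Sum>n\<in>UNIV. if n \<in> S then 1 else 0))"
    by (simp only: round_up_on_eq_floor[OF pos] sum.distrib of_int_sum[symmetric])
  also have "(\<Sum>n\<in>UNIV. if n \<in> S then 1 else 0) = int (card S)"
    by (simp flip: sum.inter_filter)
  also have "(\<Sum>n\<in>UNIV. \<lfloor>y $ n\<rfloor>) + int (card S) = int K"
    using sel s by (simp add: largest_selection_def)
  finally have "(\<Sum>n\<in>UNIV. round_up_on S y $ n) = real K"
    by simp
  moreover have "0 \<le> round_up_on S y $ n \<and> round_up_on S y $ n \<le> real (M n)" for n
  proof -
    \<comment> \<open>Both bounds are integers, so rounding cannot cross them.\<close>
    have "0 \<le> \<lfloor>y $ n\<rfloor>" "\<lceil>y $ n\<rceil> \<le> int (M n)"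
      using y(2,3)[of n] by (simp_all add: ceiling_le_iff)
    then have "0 \<le> real_of_int \<lfloor>y $ n\<rfloor>" "real_of_int \<lceil>y $ n\<rceil> \<le> real (M n)"
      by linarith+
    moreover have "real_of_int \<lfloor>y $ n\<rfloor> \<le> y $ n" "y $ n \<le> real_of_int \<lceil>y $ n\<rceil>"
      by simp_all
    ultimately show ?thesis
      unfolding round_up_on_def vec_lambda_beta by (split if_split) linarith
  qed
  moreover have "round_up_on S y $ n \<in> \<int>" for n
    by (simp add: round_up_on_def)
  ultimately show ?thesis
    by (simp add: load_vectors_def)
qed

lemma lq_norm_round_up_on_le:
  fixes x y :: "real^'n::finite"
  assumes sel: "largest_selection s (\<lambda>n. frac (y $ n)) S"
    and pos: "\<And>n. n \<in> S \<Longrightarrow> 0 < frac (y $ n)"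
    and x: "\<And>n. x $ n \<in> \<int>" "(\<Sum>n\<in>UNIV. x $ n) = (\<Sum>n\<in>UNIV. round_up_on S y $ n)"
    and q: "1 \<le> q"
  shows "lq_norm q (round_up_on S y - y) \<le> lq_norm q (x - y)"
proof -
  define t where "t n = frac (y $ n)" for n
  define D where "D u = (1 - u) powr q - u powr q" for u :: real
  have t: "0 \<le> t n" "t n < 1" for n
    by (auto simp: t_def frac_lt_1)
  have D_bounds: "-1 \<le> D (t n)" "D (t n) \<le> 1" for n
  proof -
    have "t n powr q \<le> 1" "(1 - t n) powr q \<le> 1"
      using t[of n] q by (auto intro!: powr_le1)
    then show "-1 \<le> D (t n)" "D (t n) \<le> 1"
      using powr_ge_zero[of "t n" q] powr_ge_zero[of "1 - t n" q] unfolding D_def by linarith+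
  qed
  have D_anti: "D (t n) \<le> D (t m)" if "t m \<le> t n" for m n
    unfolding D_def using that t[of m] t[of n] q by (intro diff_mono powr_mono2) auto
  obtain c where c: "-1 \<le> c" "c \<le> 1"
      and cS: "\<And>n. n \<in> S \<Longrightarrow> D (t n) \<le> c" "\<And>n. n \<notin> S \<Longrightarrow> c \<le> D (t n)"
    using largest_selection_separator[of s t S D "-1" 1] sel D_anti D_bounds
    unfolding t_def by auto
  have pointwise: "\<bar>round_up_on S y $ n - y $ n\<bar> powr q + c * (x $ n - round_up_on S y $ n)
      \<le> \<bar>x $ n - y $ n\<bar> powr q" for n
  proof -
    obtain k where k: "x $ n = of_int k"
      using x(1)[of n] by (auto elim: Ints_cases)
    define e :: int where "e = (if n \<in> S then 1 else 0)"
    have y_eq: "y $ n = of_int \<lfloor>y $ n\<rfloor> + t n"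
      by (simp add: t_def frac_def)
    have r_eq: "round_up_on S y $ n = of_int \<lfloor>y $ n\<rfloor> + of_int e"
      using round_up_on_eq_floor[OF pos] by (simp add: e_def)
    \<comment> \<open>Translating by the floor moves the entry of \<open>y\<close> to its fractional
      part, where the subgradient bound applies.\<close>
    have "\<bar>e - t n\<bar> powr q + c * ((k - \<lfloor>y $ n\<rfloor>) - e) \<le> \<bar>(k - \<lfloor>y $ n\<rfloor>) - t n\<bar> powr q"
      using powr_dist_int_ge_tangent[of "t n" q c e "k - \<lfloor>y $ n\<rfloor>"] t[of n] q c cS[of n]
      by (auto simp: e_def D_def)
    moreover have "of_int e - t n = round_up_on S y $ n - y $ n"
      "of_int (k - \<lfloor>y $ n\<rfloor>) - of_int e = x $ n - round_up_on S y $ n"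
      "of_int (k - \<lfloor>y $ n\<rfloor>) - t n = x $ n - y $ n"
      unfolding of_int_diff using y_eq r_eq k by linarith+
    ultimately show ?thesis
      by simp
  qed
  \<comment> \<open>The multiplier terms sum to zero because both vectors have the same
    total.\<close>
  have "(\<Sum>n\<in>UNIV. \<bar>round_up_on S y $ n - y $ n\<bar> powr q)
      = (\<Sum>n\<in>UNIV. \<bar>round_up_on S y $ n - y $ n\<bar> powr q + c * (x $ n - round_up_on S y $ n))"
    using x(2) by (simp add: sum.distrib sum_subtractf flip: sum_distrib_left)
  also have "\<dots> \<le> (\<Sum>n\<in>UNIV. \<bar>x $ n - y $ n\<bar> powr q)"
    by (intro sum_mono pointwise)
  finally show ?thesis
    unfolding lq_norm_def using q by (auto intro!: powr_mono2 sum_nonneg)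
qed

theorem proposition1:
  fixes r f z :: "'k::finite \<Rightarrow> 'n::finite \<Rightarrow> real"
    and d :: "'n \<Rightarrow> real" and \<omega> :: "'k \<Rightarrow> real" and M :: "'n \<Rightarrow> nat"
    and X' :: "real^'n^'k" and y' yhat :: "real^'n" and s :: int and S :: "'n set"
  assumes "\<And>k n. r k n > 0" and "\<And>k n. f k n > 0" and "\<And>n. d n > 0"
    and "\<And>k. \<omega> k \<ge> 0" and "\<And>k n. z k n \<ge> 0"
    and "\<And>n. M n > 0" and "(\<Sum>n\<in>UNIV. M n) \<ge> CARD('k)"
    and "P1_optimal r f d \<omega> z M X' y'"
    and "\<And>n. (\<Sum>k\<in>UNIV. X' $ k $ n) = y' $ n"
    and "s = int CARD('k) - (\<Sum>n\<in>UNIV. \<lfloor>y' $ n\<rfloor>)"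
    and "largest_selection s (\<lambda>n. y' $ n - of_int \<lfloor>y' $ n\<rfloor>) S"
    and "yhat = round_up_on S y'"
  shows "yhat \<in> load_vectors CARD('k) M \<and>
    (\<forall>q\<ge>1. is_arg_min (\<lambda>y. lq_norm q (y - y')) (\<lambda>y. y \<in> load_vectors CARD('k) M) yhat)"
proof -
  have feas: "P1_feasible M X' y'"
    using assms(8) by (simp add: P1_optimal_def is_arg_max_def)
  \<comment> \<open>The total load is counted by rows of \<open>X'\<close>, each of which sums to
    1.\<close>
  have "(\<Sum>n\<in>UNIV. y' $ n) = (\<Sum>k\<in>UNIV. \<Sum>n\<in>UNIV. X' $ k $ n)"
    unfolding assms(9)[symmetric] by (rule sum.swap)
  also have "\<dots> = real CARD('k)"
    using feas by (simp add: P1_feasible_def)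
  finally have sum_y': "(\<Sum>n\<in>UNIV. y' $ n) = real CARD('k)" .
  have sel: "largest_selection s (\<lambda>n. frac (y' $ n)) S"
    using assms(11) by (simp add: frac_def)
  have "(\<Sum>n\<in>UNIV. frac (y' $ n)) = of_int s"
    using sum_y' assms(10) by (simp add: frac_def sum_subtractf)
  then have pos: "0 < frac (y' $ n)" if "n \<in> S" for n
    using largest_selection_pos[OF sel _ _ that] by (simp add: frac_lt_1)
  have mem: "yhat \<in> load_vectors CARD('k) M"
    unfolding assms(12) using feas
    by (intro round_up_on_in_load_vectors[OF sum_y' _ _ assms(10) sel pos])
       (auto simp: P1_feasible_def)
  have "lq_norm q (yhat - y') \<le> lq_norm q (y - y')"
    if "1 \<le> q" "y \<in> load_vectors CARD('k) M" for q y
    using lq_norm_round_up_on_le[OF sel pos, of y q] that mem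
    by (auto simp: load_vectors_def assms(12))
  with mem show ?thesis
    by (auto simp: is_arg_min_def not_less)
qed

end
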